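(* Let $b>1$ be fixed, $p=b\log N/N$, and consider majority dynamics with independently resampled update graphs $G_t\sim\mathbb G(N,p)$ started from a deterministic configuration $y_0$. Fix $K>K_2^{\mathrm{ER}}(b)$, and let $c_1,C_2,c,\xi>0$ be constants, depending only on $b$ and $K$, having properties (A) and (B) of the context. For $s\ge0$ put $$\eta_N(s)=8\exp\Bigl(-c\frac{s^2\log N}{N}\Bigr)+2\exp\bigl(-(\log N)^2\bigr)+2N^{-\xi}.$$ Let $(h_N)$ be a sequence with $1\le h_N=o(\sqrt{\log N})$, and suppose that $R_0\ne\emptyset$, $\Delta_0\ge\sqrt N/h_N$, and moreover $\Delta_0\asymp\sqrt N/h_N$. Then for every fixed $0<\delta<1$ and all sufficiently large $N$, $$\mathbb P\Bigl(R_{\lfloor(1-\delta)\frac{\log N}{\log\log N}\rfloor}\ne\emptyset,\ R_{\lceil(1+\delta)\frac{\log N}{\log\log N}\rceil}=\emptyset\,\Big|\,y_0\Bigr)\ge1-\eta_N(\Delta_0).$$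
   Context: Majority dynamics with resampling: the vertex set is $[N]=\{1,\dots,N\}$; $y_t\in\{\pm1\}^{[N]}$ is the configuration at day $t$ ($+1$ = blue, $-1$ = red), $B_t=\{v:y_t(v)=+1\}$, $R_t=\{v:y_t(v)=-1\}$, $\Delta_t=|B_t|-|R_t|$. The graphs $G_1,G_2,\dots$ are i.i.d. Erdős–Rényi graphs $\mathbb G(N,p)$ on $[N]$, independent of the fixed initial configuration $y_0$. At day $t+1$ all vertices update synchronously: if in $G_{t+1}$ the vertex $v$ has strictly more neighbors in $B_t$ than in $R_t$ then $y_{t+1}(v)=+1$; if strictly fewer then $y_{t+1}(v)=-1$; if equal then $y_{t+1}(v)=y_t(v)$. Logarithms are natural; $\Phi$ is the standard normal distribution function. Constants: $r_*=\frac12\bigl(1-\frac{\sqrt{2b-1}}{b}\bigr)$ and $K_2^{\mathrm{ER}}(b)=\frac1{\sqrt b}\Phi^{-1}(1-r_* )$. Property (A) (stepwise amplification): whenever $\sqrt{N/\log N}\le\Delta_t\le KN/\sqrt{\log N}$, $$\mathbb P\bigl(c_1\sqrt{\log N}\,\Delta_t\le\Delta_{t+1}\le C_2\sqrt{\log N}\,\Delta_t\,\big|\,y_t\bigr)\ge1-2\exp\Bigl(-c\frac{\Delta_t^2\log N}{N}\Bigr).$$ Property (B) (two-day unanimity): for all sufficiently large $N$ and every initial configuration with $\Delta_0\ge KN/\sqrt{\log N}$, $\mathbb P(R_2=\emptyset\mid y_0)\ge1-2\exp(-(\log N)^2)-2N^{-\xi}$. Constants depending only on $(b,K)$ with properties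 (A) and (B) exist (these are separate results of the same paper). $\Delta_0\asymp\sqrt N/h_N$ means $\Delta_0$ is bounded above and below by positive constant multiples (independent of $N$) of $\sqrt N/h_N$. *)

theory Defs
  imports "HOL-Probability.Probability" "HOL-Library.Landau_Symbols"
begin

text \<open>A graph on \<open>{1..N}\<close> is represented by its set of edges (two-element sets of vertices).\<close>

definition possible_edges :: "nat \<Rightarrow> nat set set" where
  "possible_edges N = {e. e \<subseteq> {1..N} \<and> card e = 2}"

definition erdos_renyi :: "nat \<Rightarrow> real \<Rightarrow> nat set set pmf" where
  "erdos_renyi N p =
     map_pmf (\<lambda>x. {e \<in> possible_edges N. x e})
       (Pi_pmf (possible_edges N) False (\<lambda>_. bernoulli_pmf p))"

text \<open>An outcome \<open>G\<close> of this space is a sequence of independent graphs. It is indexed from \<open>0\<close>: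
  \<open>G t\<close> is the graph revealed on day \<open>t + 1\<close>, which takes the configuration of day \<open>t\<close> to that of
  day \<open>t + 1\<close>.\<close>

definition graph_space :: "nat \<Rightarrow> real \<Rightarrow> (nat \<Rightarrow> nat set set) measure" where
  "graph_space N p = (\<Pi>\<^sub>M t\<in>(UNIV :: nat set). measure_pmf (erdos_renyi N p))"

text \<open>Configurations are extensional functions, so that \<open>y = y'\<close> means agreement on \<open>{1..N}\<close>.\<close>

definition configs :: "nat \<Rightarrow> (nat \<Rightarrow> int) set" where
  "configs N = {1..N} \<rightarrow>\<^sub>E {-1, 1}"

definition blue :: "nat \<Rightarrow> (nat \<Rightarrow> int) \<Rightarrow> nat set" where
  "blue N y = {v \<in> {1..N}. y v = 1}"

definition red :: "nat \<Rightarrow> (nat \<Rightarrow> int) \<Rightarrow> nat set" where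
  "red N y = {v \<in> {1..N}. y v = -1}"

definition advantage :: "nat \<Rightarrow> (nat \<Rightarrow> int) \<Rightarrow> real" where
  "advantage N y = real (card (blue N y)) - real (card (red N y))"

definition neighbors :: "nat set set \<Rightarrow> nat \<Rightarrow> nat set" where
  "neighbors E v = {u. {u, v} \<in> E}"

definition majority_step :: "nat \<Rightarrow> nat set set \<Rightarrow> (nat \<Rightarrow> int) \<Rightarrow> (nat \<Rightarrow> int)" where
  "majority_step N E y =
     (\<lambda>v\<in>{1..N}.
        let nb = card (neighbors E v \<inter> blue N y); nr = card (neighbors E v \<inter> red N y)
        in if nb > nr then 1 else if nb < nr then -1 else y v)"

primrec majority_dynamics ::
    "nat \<Rightarrow> (nat \<Rightarrow> int) \<Rightarrow> (nat \<Rightarrow> nat set set) \<Rightarrow> nat \<Rightarrow> (nat \<Rightarrow> int)" where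
  "majority_dynamics N y0 G 0 = y0"
| "majority_dynamics N y0 G (Suc t) = majority_step N (G t) (majority_dynamics N y0 G t)"

definition std_normal_cdf :: "real \<Rightarrow> real" where
  "std_normal_cdf = cdf std_normal_distribution"

definition r_star :: "real \<Rightarrow> real" where
  "r_star b = 1 / 2 * (1 - sqrt (2 * b - 1) / b)"

definition K2_ER :: "real \<Rightarrow> real" where
  "K2_ER b = 1 / sqrt b * inv std_normal_cdf (1 - r_star b)"

text \<open>Conditioning on \<open>y\<^sub>t\<close> is conditioning on each configuration \<open>y\<close> that \<open>y\<^sub>t\<close>
  takes with positive probability. The bound is uniform over initial configurations and days and
  is required for all sufficiently large \<open>N\<close>.\<close>

definition stepwise_amplification :: "real \<Rightarrow> real \<Rightarrow> real \<Rightarrow> real \<Rightarrow> real \<Rightarrow> bool" where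
  "stepwise_amplification b K c1 C2 c \<longleftrightarrow>
     (\<forall>\<^sub>F N in sequentially.
        let M = graph_space N (b * ln (real N) / real N) in
        \<forall>y0 \<in> configs N. \<forall>t. \<forall>y \<in> configs N.
          \<P>(G in M. majority_dynamics N y0 G t = y) > 0 \<longrightarrow>
          sqrt (real N / ln (real N)) \<le> advantage N y \<longrightarrow>
          advantage N y \<le> K * real N / sqrt (ln (real N)) \<longrightarrow>
          \<P>(G in M.
              c1 * sqrt (ln (real N)) * advantage N (majority_dynamics N y0 G t)
                \<le> advantage N (majority_dynamics N y0 G (Suc t)) \<and>
              advantage N (majority_dynamics N y0 G (Suc t))
                \<le> C2 * sqrt (ln (real N)) * advantage N (majority_dynamics N y0 G t)
            \<bar> majority_dynamics N y0 G t = y)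
          \<ge> 1 - 2 * exp (- (c * (advantage N y)\<^sup>2 * ln (real N) / real N)))"

text \<open>The initial configuration is deterministic, so conditioning on it is void.\<close>

definition two_day_unanimity :: "real \<Rightarrow> real \<Rightarrow> real \<Rightarrow> bool" where
  "two_day_unanimity b K \<xi> \<longleftrightarrow>
     (\<forall>\<^sub>F N in sequentially.
        \<forall>y0 \<in> configs N.
          advantage N y0 \<ge> K * real N / sqrt (ln (real N)) \<longrightarrow>
          \<P>(G in graph_space N (b * ln (real N) / real N).
              red N (majority_dynamics N y0 G 2) = {})
          \<ge> 1 - 2 * exp (- (ln (real N))\<^sup>2) - 2 * real N powr (- \<xi>))"

definition eta :: "real \<Rightarrow> real \<Rightarrow> nat \<Rightarrow> real \<Rightarrow> real" where
  "eta c \<xi> N s =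
     8 * exp (- (c * s\<^sup>2 * ln (real N) / real N))
       + 2 * exp (- (ln (real N))\<^sup>2) + 2 * real N powr (- \<xi>)"

end

theory Submission
  imports Defs "HOL-Real_Asymp.Real_Asymp"
begin

text \<open>
  Write \<open>L = ln N\<close>, \<open>x\<close> for the initial advantage and \<open>\<kappa> = c L / N\<close>. As long as no step violates (A),
  the advantage on day \<open>t\<close> lies between \<open>(c\<^sub>1 \<surd>L)\<^sup>t x\<close> and \<open>(C\<^sub>2 \<surd>L)\<^sup>t x\<close>. Since \<open>x\<close> is
  \<open>\<surd>N\<close> up to factors of order \<open>\<surd>L\<close> and each step gains \<open>(ln L) / 2 + O(1)\<close> on a logarithmic
  scale where \<open>L / 2\<close> is needed, the threshold \<open>K N / \<surd>L\<close> is crossed at about \<open>L / ln L\<close> days;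
  two more days then remove the red vertices by (B), and unanimity is absorbing.
  The threshold is crossed at a random time; instead of stopping there, both bounds are proved
  by induction on the number of remaining days, with a first-step decomposition of the Markov
  chain. The failure probabilities of (A) along the chain add up to
  \<open>\<Sum>\<^sub>k 2 exp (- \<kappa> (c\<^sub>1 \<surd>L)\<^sup>2\<^sup>k x\<^sup>2) \<le> 4 exp (- \<kappa> x\<^sup>2)\<close>, once for each of the two times, which gives
  the factor \<open>8\<close> in \<open>eta\<close>.
\<close>

section \<open>The law of the dynamics as a Markov chain\<close>

text \<open>This is the first-step estimate of both inductions: conditionally on the first step, the
  event has probability at most 1 after a bad outcome and at most \<open>e2\<close> after a good
  one.\<close>

lemma measure_bind_pmf_le:
  fixes p :: "'a pmf" and f :: "'a \<Rightarrow> 'b pmf"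
  assumes bad: "measure_pmf.prob p {x. \<not> good x} \<le> e1"
    and good: "\<And>x. x \<in> set_pmf p \<Longrightarrow> good x \<Longrightarrow> measure_pmf.prob (f x) A \<le> e2"
    and "0 \<le> e2"
  shows "measure_pmf.prob (bind_pmf p f) A \<le> e1 + e2"
proof -
  have "0 \<le> e1"
    using bad measure_nonneg order_trans by blast
  have "emeasure (bind_pmf p f) A = (\<integral>\<^sup>+x. emeasure (f x) A \<partial>p)"
    by simp
  also have "\<dots> \<le> (\<integral>\<^sup>+x. indicator {x. \<not> good x} x + ennreal e2 \<partial>p)"
  proof (rule nn_integral_mono_AE, rule AE_pmfI)
    fix x assume x: "x \<in> set_pmf p"
    show "emeasure (f x) A \<le> indicator {x. \<not> good x} x + ennreal e2"
    proof (cases "good x")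
      case True
      then show ?thesis
        using good[OF x] by (simp add: measure_pmf.emeasure_eq_measure ennreal_leI)
    next
      case False
      then show ?thesis
        by (simp add: add_increasing2 measure_pmf.emeasure_le_1)
    qed
  qed
  also have "\<dots> = ennreal (measure_pmf.prob p {x. \<not> good x}) + ennreal e2"
    by (subst nn_integral_add) (simp_all add: measure_pmf.emeasure_eq_measure)
  also have "\<dots> \<le> ennreal (e1 + e2)"
    using bad \<open>0 \<le> e1\<close> \<open>0 \<le> e2\<close> by (simp add: ennreal_plus[symmetric] ennreal_leI del: ennreal_plus)
  finally show ?thesis
    using \<open>0 \<le> e1\<close> \<open>0 \<le> e2\<close>
    by (simp add: measure_pmf.emeasure_eq_measure ennreal_plus[symmetric] del: ennreal_plus)
qed

definition step_law :: "nat \<Rightarrow> real \<Rightarrow> (nat \<Rightarrow> int) \<Rightarrow> (nat \<Rightarrow> int) pmf" where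
  "step_law N p y = map_pmf (\<lambda>E. majority_step N E y) (erdos_renyi N p)"

text \<open>The recursion splits off the first day, not the last, so that an induction hypothesis
  can be applied to the configuration after one step.\<close>

primrec dynamics_law :: "nat \<Rightarrow> real \<Rightarrow> nat \<Rightarrow> (nat \<Rightarrow> int) \<Rightarrow> (nat \<Rightarrow> int) pmf" where
  "dynamics_law N p 0 y = return_pmf y"
| "dynamics_law N p (Suc n) y = bind_pmf (step_law N p y) (dynamics_law N p n)"

lemma dynamics_law_1: "dynamics_law N p (Suc 0) y = step_law N p y"
  by (simp add: bind_return_pmf' cong: bind_pmf_cong)

lemma configs_values: "y \<in> configs N \<Longrightarrow> v \<in> {1..N} \<Longrightarrow> y v = 1 \<or> y v = -1"
  by (auto simp: configs_def PiE_iff)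

lemma majority_step_in_configs: "y \<in> configs N \<Longrightarrow> majority_step N E y \<in> configs N"
  unfolding majority_step_def configs_def by (auto simp: Let_def PiE_iff)

lemma majority_dynamics_in_configs: "y \<in> configs N \<Longrightarrow> majority_dynamics N y G n \<in> configs N"
  by (induction n) (auto intro: majority_step_in_configs)

lemma finite_configs: "finite (configs N)"
  unfolding configs_def by (intro finite_PiE) auto

lemma set_step_law_configs: "y \<in> configs N \<Longrightarrow> set_pmf (step_law N p y) \<subseteq> configs N"
  by (auto simp: step_law_def majority_step_in_configs)

lemma space_graph_space [simp]: "space (graph_space N p) = UNIV"
  by (simp add: graph_space_def space_PiM)

lemma majority_dynamics_shift:
  "majority_dynamics N y (case_nat E G) (Suc n) = majority_dynamics N (majority_step N E y) G n"
  by (induction n) auto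

text \<open>For each fixed configuration of day \<open>n\<close> the next one depends on the
  coordinate \<open>G n\<close> alone. Since there are only finitely many configurations, composing
  with the random configuration of day \<open>n\<close> stays measurable.\<close>

lemma measurable_majority_dynamics:
  assumes y: "y \<in> configs N"
  shows "(\<lambda>G. majority_dynamics N y G n) \<in> graph_space N p \<rightarrow>\<^sub>M count_space (configs N)"
proof (induction n)
  case 0
  then show ?case using y by simp
next
  case (Suc n)
  have "(\<lambda>G. majority_step N (G n) z) \<in> graph_space N p \<rightarrow>\<^sub>M count_space (configs N)"
    if "z \<in> configs N" for z
  proof -
    have "(\<lambda>E. majority_step N E z) \<in> measure_pmf (erdos_renyi N p) \<rightarrow>\<^sub>M count_space (configs N)"
      using that by (auto intro: majority_step_in_configs)
    moreover have "(\<lambda>G. G n) \<in> graph_space N p \<rightarrow>\<^sub>M measure_pmf (erdos_renyi N p)"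
      unfolding graph_space_def by (rule measurable_component_singleton) simp
    ultimately show ?thesis by (rule measurable_compose[rotated])
  qed
  from measurable_compose_countable'[OF this Suc] show ?case
    by (simp add: countable_finite finite_configs)
qed

lemma sets_majority_dynamics:
  assumes y: "y \<in> configs N"
  shows "{G. majority_dynamics N y G n \<in> A} \<in> sets (graph_space N p)"
proof -
  \<comment> \<open>The set \<open>A\<close> is arbitrary and may leave \<open>configs N\<close>,
    while measurability is into the count space on \<open>configs N\<close>.\<close>
  have eq: "{G. majority_dynamics N y G n \<in> A} =
      (\<lambda>G. majority_dynamics N y G n) -` (A \<inter> configs N) \<inter> space (graph_space N p)"
    using majority_dynamics_in_configs[OF y] by auto
  show ?thesis
    unfolding eq by (rule measurable_sets[OF measurable_majority_dynamics[OF y]]) simp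
qed

interpretation graph_space: prob_space "graph_space N p" for N p
  unfolding graph_space_def by (intro prob_space_PiM measure_pmf.prob_space_axioms)

text \<open>The sequence of graphs is an independent first graph followed by a sequence of the same
  law. By Fubini the first graph is integrated out, and \<open>majority_dynamics_shift\<close> turns
  the inner probability into the induction hypothesis.\<close>

lemma emeasure_majority_dynamics:
  assumes "y \<in> configs N"
  shows "emeasure (graph_space N p) {G. majority_dynamics N y G n \<in> A}
    = emeasure (dynamics_law N p n y) A"
  using assms
proof (induction n arbitrary: y)
  case 0
  show ?case
    using graph_space.emeasure_space_1[of N p] by (auto simp: indicator_def)
next
  case (Suc n)
  interpret sequence_space "measure_pmf (erdos_renyi N p)" ..
  let ?P = "measure_pmf (erdos_renyi N p)" and ?S = "graph_space N p"
  let ?X = "{G. majority_dynamics N y G (Suc n) \<in> A}"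
  let ?Y = "(\<lambda>(E, G). case_nat E G) -` ?X"
  have [simp]: "sigma_finite_measure ?S"
    by (rule graph_space.sigma_finite_measure_axioms)
  have X: "?X \<in> sets ?S"
    by (rule sets_majority_dynamics[OF Suc.prems])
  have meas: "(\<lambda>(E, G). case_nat E G) \<in> ?P \<Otimes>\<^sub>M ?S \<rightarrow>\<^sub>M ?S"
    unfolding graph_space_def by measurable
  \<comment> \<open>Prepending an independent graph preserves the product measure.\<close>
  have iter: "distr (?P \<Otimes>\<^sub>M ?S) ?S (\<lambda>(E, G). case_nat E G) = ?S"
    unfolding graph_space_def by (rule PiM_iter)
  have "emeasure ?S ?X = emeasure (?P \<Otimes>\<^sub>M ?S) (?Y \<inter> space (?P \<Otimes>\<^sub>M ?S))"
    by (subst iter[symmetric], rule emeasure_distr[OF meas X])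
  also have "?Y \<inter> space (?P \<Otimes>\<^sub>M ?S) = ?Y"
    by (simp add: space_pair_measure)
  also have "emeasure (?P \<Otimes>\<^sub>M ?S) ?Y = (\<integral>\<^sup>+E. emeasure ?S (Pair E -` ?Y) \<partial>?P)"
    using measurable_sets[OF meas X]
    by (intro sigma_finite_measure.emeasure_pair_measure_alt) (simp_all add: space_pair_measure)
  also have "\<dots> = (\<integral>\<^sup>+E. emeasure (dynamics_law N p n (majority_step N E y)) A \<partial>?P)"
  proof (rule nn_integral_cong)
    fix E
    have "Pair E -` ?Y = {G. majority_dynamics N (majority_step N E y) G n \<in> A}"
      by (simp add: vimage_def majority_dynamics_shift del: majority_dynamics.simps)
    then show "emeasure ?S (Pair E -` ?Y) = emeasure (dynamics_law N p n (majority_step N E y)) A"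
      by (simp add: Suc.IH majority_step_in_configs Suc.prems)
  qed
  also have "\<dots> = emeasure (dynamics_law N p (Suc n) y) A"
    by (simp add: step_law_def)
  finally show ?case .
qed

lemma prob_majority_dynamics:
  assumes "y \<in> configs N"
  shows "\<P>(G in graph_space N p. majority_dynamics N y G n \<in> A)
    = measure_pmf.prob (dynamics_law N p n y) A"
  using emeasure_majority_dynamics[OF assms, of p n A] by (simp add: measure_def)

section \<open>Unanimity: its advantage and its absorption\<close>

lemma advantage_eq:
  assumes "y \<in> configs N"
  shows "advantage N y = real N - 2 * real (card (red N y))"
proof -
  have "blue N y \<union> red N y = {1..N}" "blue N y \<inter> red N y = {}"
    unfolding blue_def red_def using configs_values[OF assms] by force+
  moreover have "finite (blue N y)" "finite (red N y)"
    by (auto simp: blue_def red_def)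
  ultimately have "card (blue N y) + card (red N y) = N"
    by (metis card_Un_disjoint card_atLeastAtMost diff_Suc_1)
  then show ?thesis by (simp add: advantage_def)
qed

lemma advantage_eq_iff:
  assumes "y \<in> configs N"
  shows "red N y = {} \<longleftrightarrow> advantage N y = real N"
  using advantage_eq[OF assms] by (auto simp: red_def)

text \<open>A vertex without red neighbors sees either a blue majority or a tie, and a tie keeps its
  blue color.\<close>

lemma red_majority_step_empty:
  assumes "y \<in> configs N" "red N y = {}"
  shows "red N (majority_step N E y) = {}"
proof -
  have "majority_step N E y v = 1" if "v \<in> {1..N}" for v
  proof -
    have "y v = 1"
      using configs_values[OF assms(1) that] assms(2) that by (auto simp: red_def)
    then show ?thesis
      using that assms(2) by (simp add: majority_step_def Let_def)
  qed
  then show ?thesis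
    by (auto simp: red_def)
qed

lemma red_majority_dynamics_empty_mono:
  assumes "y \<in> configs N" "red N (majority_dynamics N y G m) = {}" "m \<le> n"
  shows "red N (majority_dynamics N y G n) = {}"
  using assms(3)
  by (induction n rule: dec_induct)
    (simp_all add: assms red_majority_step_empty majority_dynamics_in_configs)

text \<open>The two laws are compared on the common space of graph sequences, where absorption gives
  an inclusion of events.\<close>

lemma prob_red_nonempty_antimono:
  assumes "y \<in> configs N" "m \<le> n"
  shows "measure_pmf.prob (dynamics_law N p n y) {z. red N z \<noteq> {}}
    \<le> measure_pmf.prob (dynamics_law N p m y) {z. red N z \<noteq> {}}"
  unfolding prob_majority_dynamics[OF assms(1), symmetric]
  using red_majority_dynamics_empty_mono[OF assms(1) _ assms(2)]
    sets_majority_dynamics[OF assms(1), of m "{z. red N z \<noteq> {}}"]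
  by (intro graph_space.finite_measure_mono) auto

section \<open>Error bounds along the chain\<close>

definition step_ok :: "nat \<Rightarrow> real \<Rightarrow> real \<Rightarrow> (nat \<Rightarrow> int) \<Rightarrow> (nat \<Rightarrow> int) \<Rightarrow> bool" where
  "step_ok N g D y z \<longleftrightarrow>
     g * advantage N y \<le> advantage N z \<and> advantage N z \<le> D * advantage N y"

text \<open>\<open>s\<close> and \<open>H\<close> are the two ends of the window of advantages in which (A) applies.\<close>

locale amplification =
  fixes N :: nat and p g D s H \<kappa> :: real
  assumes g: "1 \<le> g" and D: "1 \<le> D" and s: "0 < s" and \<kappa>: "0 < \<kappa>"
    and step: "\<And>y. y \<in> configs N \<Longrightarrow> s \<le> advantage N y \<Longrightarrow> advantage N y \<le> H \<Longrightarrow>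
      measure_pmf.prob (step_law N p y) {z. \<not> step_ok N g D y z}
        \<le> 2 * exp (- \<kappa> * (advantage N y)\<^sup>2)"
begin

definition err :: "nat \<Rightarrow> real \<Rightarrow> real" where
  "err n x = (\<Sum>k<n. 2 * exp (- \<kappa> * (g ^ k * x)\<^sup>2))"

lemma err_nonneg: "0 \<le> err n x"
  unfolding err_def by (intro sum_nonneg) simp

lemma err_Suc: "err (Suc n) x = 2 * exp (- \<kappa> * x\<^sup>2) + err n (g * x)"
  unfolding err_def by (subst sum.lessThan_Suc_shift) (simp add: mult.assoc mult.left_commute)

text \<open>After a good step from advantage \<open>x\<close> the new advantage is random but at
  least \<open>g * x\<close>; this replaces its error by the one at \<open>g * x\<close>.\<close>

lemma err_antimono:
  assumes "0 \<le> x" "x \<le> x'"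
  shows "err n x' \<le> err n x"
  unfolding err_def using assms g \<kappa>
  by (intro sum_mono) (auto intro!: mult_left_mono power_mono mult_nonneg_nonneg)

lemma step_ok_advantage:
  assumes "s \<le> advantage N y" "step_ok N g D y z"
  shows "s \<le> advantage N z"
proof -
  have "advantage N y \<le> g * advantage N y"
    using assms(1) s g by (simp add: mult_le_cancel_right1)
  then show ?thesis
    using assms by (simp add: step_ok_def)
qed

text \<open>Along good steps the advantage grows at most by the factor \<open>D\<close> a day. The
  bound by \<open>H\<close> keeps every step inside the window, and the bound by \<open>N\<close>
  leaves a red vertex at the end.\<close>

lemma prob_red_empty_le:
  assumes "y \<in> configs N" "s \<le> advantage N y"
    and "D ^ n * advantage N y \<le> H" "D ^ n * advantage N y < real N"
  shows "measure_pmf.prob (dynamics_law N p n y) {z. red N z = {}} \<le> err n (advantage N y)"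
  using assms
proof (induction n arbitrary: y)
  case 0
  then show ?case
    by (simp add: err_def advantage_eq_iff)
next
  case (Suc n)
  let ?x = "advantage N y"
  have "0 < ?x"
    using Suc.prems s by linarith
  moreover have "1 \<le> D ^ Suc n"
    using D by (rule one_le_power)
  ultimately have "?x \<le> D ^ Suc n * ?x"
    by (simp add: mult_le_cancel_right1 del: power_Suc)
  \<comment> \<open>The bound on the final advantage already bounds the present one, so the step
    estimate applies.\<close>
  then have "?x \<le> H"
    using Suc.prems by linarith
  have "measure_pmf.prob (dynamics_law N p n z) {z. red N z = {}} \<le> err n (g * ?x)"
    if z: "z \<in> set_pmf (step_law N p y)" "step_ok N g D y z" for z
  proof -
    have "D ^ n * advantage N z \<le> D ^ n * (D * ?x)"
      using z D by (intro mult_left_mono) (auto simp: step_ok_def)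
    then have "D ^ n * advantage N z \<le> D ^ Suc n * ?x"
      by (simp add: mult_ac)
    then have "measure_pmf.prob (dynamics_law N p n z) {z. red N z = {}} \<le> err n (advantage N z)"
      using z Suc.prems set_step_law_configs step_ok_advantage by (intro Suc.IH) auto
    also have "\<dots> \<le> err n (g * ?x)"
      using z g \<open>0 < ?x\<close> by (intro err_antimono) (auto simp: step_ok_def)
    finally show ?thesis .
  qed
  then show ?case
    unfolding dynamics_law.simps err_Suc
    using step[OF Suc.prems(1,2) \<open>?x \<le> H\<close>]
    by (intro measure_bind_pmf_le[where good = "step_ok N g D y"] err_nonneg) auto
qed

text \<open>Each day splits into two cases. Once the advantage has reached \<open>H\<close>, two
  days suffice up to \<open>\<epsilon>\<close> and further days do no harm; below \<open>H\<close>
  one more good step passes the growth hypothesis on. The cases are alternatives, so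
  \<open>\<epsilon>\<close> is paid only once.\<close>

lemma prob_red_nonempty_le:
  assumes unan: "\<And>y. y \<in> configs N \<Longrightarrow> H \<le> advantage N y \<Longrightarrow>
      measure_pmf.prob (dynamics_law N p 2 y) {z. red N z \<noteq> {}} \<le> \<epsilon>"
    and "0 \<le> \<epsilon>"
    and "y \<in> configs N" "s \<le> advantage N y" "H \<le> g ^ n * advantage N y"
  shows "measure_pmf.prob (dynamics_law N p (n + 2) y) {z. red N z \<noteq> {}}
    \<le> err n (advantage N y) + \<epsilon>"
  using assms(3-)
proof (induction n arbitrary: y)
  case 0
  then show ?case
    using unan by (simp add: err_def numeral_2_eq_2)
next
  case (Suc n)
  let ?x = "advantage N y" and ?R = "{z. red N z \<noteq> {}}"
  show ?case
  proof (cases "H \<le> ?x")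
    case True
    have "measure_pmf.prob (dynamics_law N p (Suc n + 2) y) ?R
        \<le> measure_pmf.prob (dynamics_law N p 2 y) ?R"
      by (rule prob_red_nonempty_antimono[OF Suc.prems(1)]) simp
    then show ?thesis
      using unan[OF Suc.prems(1) True] err_nonneg[of "Suc n" ?x] by linarith
  next
    case False
    have "0 < ?x"
      using Suc.prems s by linarith
    have "measure_pmf.prob (dynamics_law N p (n + 2) z) ?R \<le> err n (g * ?x) + \<epsilon>"
      if z: "z \<in> set_pmf (step_law N p y)" "step_ok N g D y z" for z
    proof -
      have "g ^ n * (g * ?x) \<le> g ^ n * advantage N z"
        using z g by (intro mult_left_mono) (auto simp: step_ok_def)
      then have "H \<le> g ^ n * advantage N z"
        using Suc.prems by (simp add: mult_ac)
      then have "measure_pmf.prob (dynamics_law N p (n + 2) z) ?R \<le> err n (advantage N z) + \<epsilon>"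
        using z Suc.prems set_step_law_configs step_ok_advantage by (intro Suc.IH) auto
      also have "\<dots> \<le> err n (g * ?x) + \<epsilon>"
        using z g \<open>0 < ?x\<close> by (intro add_right_mono err_antimono) (auto simp: step_ok_def)
      finally show ?thesis .
    qed
    then have "measure_pmf.prob (dynamics_law N p (Suc (n + 2)) y) ?R
        \<le> 2 * exp (- \<kappa> * ?x\<^sup>2) + (err n (g * ?x) + \<epsilon>)"
      unfolding dynamics_law.simps
      using step[OF Suc.prems(1,2)] False \<open>0 \<le> \<epsilon>\<close>
      by (intro measure_bind_pmf_le[where good = "step_ok N g D y"] add_nonneg_nonneg err_nonneg) auto
    then show ?thesis
      by (simp add: err_Suc)
  qed
qed

text \<open>With \<open>a = \<kappa> * x\<^sup>2\<close>, the bound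
  \<open>g ^ (2 * k) \<ge> k + 1\<close> makes the \<open>k\<close>-th exponential at most
  \<open>exp (- a) ^ (k + 1)\<close>. As \<open>a \<ge> 1\<close> gives
  \<open>exp (- a) \<le> 1 / 2\<close>, a geometric series with sum at most 2 remains.\<close>

lemma err_le:
  assumes "2 \<le> g" "1 \<le> \<kappa> * x\<^sup>2"
  shows "err n x \<le> 4 * exp (- \<kappa> * x\<^sup>2)"
proof -
  define a where "a = \<kappa> * x\<^sup>2"
  have "1 \<le> a" using assms by (simp add: a_def)
  have "2 \<le> exp (1::real)"
    using exp_ge_add_one_self[of "1::real"] by simp
  also have "\<dots> \<le> exp a"
    using \<open>1 \<le> a\<close> by simp
  finally have half: "exp (- a) \<le> 1 / 2"
    by (simp add: exp_minus field_simps)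
  have "exp (- \<kappa> * (g ^ k * x)\<^sup>2) \<le> exp (- a) * (1 / 2) ^ k" for k
  proof -
    have "real (Suc k) \<le> 2 ^ k"
      by (metis Suc_leI less_exp of_nat_le_iff of_nat_numeral of_nat_power)
    also have "\<dots> \<le> g ^ k"
      using assms(1) by (intro power_mono) auto
    also have "\<dots> \<le> (g ^ k)\<^sup>2"
      using assms(1) by (intro self_le_power one_le_power) auto
    finally have "a * real (Suc k) \<le> a * (g ^ k)\<^sup>2"
      using \<open>1 \<le> a\<close> by (intro mult_left_mono) auto
    then have "exp (- \<kappa> * (g ^ k * x)\<^sup>2) \<le> exp (real (Suc k) * - a)"
      by (simp add: a_def power_mult_distrib algebra_simps)
    also have "\<dots> = exp (- a) * exp (- a) ^ k"
      unfolding exp_of_nat_mult by simp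
    also have "\<dots> \<le> exp (- a) * (1 / 2) ^ k"
      using half by (intro mult_left_mono power_mono) auto
    finally show ?thesis .
  qed
  then have "err n x \<le> (\<Sum>k<n. 2 * (exp (- a) * (1 / 2) ^ k))"
    unfolding err_def by (intro sum_mono) auto
  also have "\<dots> = 2 * exp (- a) * (\<Sum>k<n. (1 / 2) ^ k)"
    by (simp add: sum_distrib_left mult.assoc)
  also have "(\<Sum>k<n. (1 / 2 :: real) ^ k) \<le> 2"
    by (simp add: geometric_sum)
  finally show ?thesis
    by (simp add: a_def)
qed

end

section \<open>Nonnegativity of the threshold constant\<close>

text \<open>The density is even and the point 0 carries no mass, so the value at 0 is exactly 1/2;
  the rest is monotonicity.\<close>

lemma std_normal_cdf_nonpos_le_half:
  assumes "x \<le> 0"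
  shows "std_normal_cdf x \<le> 1 / 2"
proof -
  interpret real_distribution std_normal_distribution
    by (rule real_dist_normal_dist)
  have "emeasure std_normal_distribution {0..} = emeasure std_normal_distribution {..0}"
  proof -
    have "emeasure std_normal_distribution {0..}
        = (\<integral>\<^sup>+x. ennreal (std_normal_density x) * indicator {0..} x \<partial>lborel)"
      by (simp add: emeasure_density)
    also have "\<dots> = (\<integral>\<^sup>+x. ennreal (std_normal_density (- x)) * indicator {0..} (- x) \<partial>lborel)"
      using nn_integral_real_affine[of "\<lambda>x. ennreal (std_normal_density x) * indicator {0..} x" "- 1" 0]
      by simp
    also have "\<dots> = (\<integral>\<^sup>+x. ennreal (std_normal_density x) * indicator {..0} x \<partial>lborel)"
      by (intro nn_integral_cong) (auto simp: normal_density_def indicator_def)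
    also have "\<dots> = emeasure std_normal_distribution {..0}"
      by (simp add: emeasure_density)
    finally show ?thesis .
  qed
  then have "prob {0..} = prob {..0}"
    by (simp add: measure_def)
  moreover have "prob {0} = 0"
    by (simp add: measure_def emeasure_density nn_integral_indicator_singleton)
  moreover have "prob ({0} \<union> {0<..}) = prob {0} + prob {0<..}"
    by (rule finite_measure_Union) auto
  moreover have "{0} \<union> {0<..} = {0 :: real..}"
    by auto
  moreover have "prob {..0} = 1 - prob {0<..}"
    using prob_compl[of "{0<..}"] by (auto simp: Compl_eq_Diff_UNIV[symmetric])
  ultimately have "cdf std_normal_distribution 0 = 1 / 2"
    by (simp add: cdf_def)
  then show ?thesis
    using cdf_nondecreasing[OF assms] by (simp add: std_normal_cdf_def)
qed

text \<open>The distribution has no atoms, so its distribution function is continuous, and the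
  limits 0 and 1 allow the intermediate value theorem.\<close>

lemma std_normal_cdf_surj:
  assumes "0 < v" "v < 1"
  shows "\<exists>x. std_normal_cdf x = v"
proof -
  interpret real_distribution std_normal_distribution
    by (rule real_dist_normal_dist)
  have cont: "isCont (cdf std_normal_distribution) x" for x
    unfolding isCont_cdf by (simp add: measure_def emeasure_density nn_integral_indicator_singleton)
  have "\<forall>\<^sub>F x in at_bot. cdf std_normal_distribution x < v"
    using cdf_lim_at_bot assms(1) by (rule order_tendstoD)
  then obtain x where x: "cdf std_normal_distribution x < v"
    by (auto simp: eventually_at_bot_linorder)
  have "\<forall>\<^sub>F x in at_top. v < cdf std_normal_distribution x"
    using cdf_lim_at_top_prob assms(2) by (rule order_tendstoD)
  then obtain x' where x': "v < cdf std_normal_distribution x'"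
    by (auto simp: eventually_at_top_linorder)
  have "x \<le> x'"
    using x x' cdf_nondecreasing[of x' x] by (meson le_cases not_less order_trans less_le_trans)
  then show ?thesis
    using IVT[of "cdf std_normal_distribution" x v x'] x x' cont
    by (auto simp: std_normal_cdf_def)
qed

text \<open>Since \<open>inv\<close> is a choice operator, it has to be checked that \<open>1 - r_star b\<close> is in the range of
  the distribution function.\<close>

lemma K2_ER_nonneg:
  assumes "1 < b"
  shows "0 \<le> K2_ER b"
proof -
  \<comment> \<open>Expanded, this is \<open>2 * b - 1 < b\<^sup>2\<close>, which puts
    \<open>r_star b\<close> strictly between 0 and 1/2.\<close>
  have "0 < (b - 1)\<^sup>2"
    using assms by simp
  then have "sqrt (2 * b - 1) < b"
    using assms by (intro real_less_lsqrt) (auto simp: power2_eq_square algebra_simps)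
  moreover have "0 < sqrt (2 * b - 1)"
    using assms by simp
  moreover define q where "q = sqrt (2 * b - 1) / b"
  ultimately have "0 < q" "q < 1"
    using assms by auto
  then have r: "0 < r_star b" "r_star b < 1 / 2"
    by (simp_all add: r_star_def q_def[symmetric])
  then obtain x where "std_normal_cdf x = 1 - r_star b"
    using std_normal_cdf_surj[of "1 - r_star b"] by auto
  then have "std_normal_cdf (inv std_normal_cdf (1 - r_star b)) = 1 - r_star b"
    by (metis f_inv_into_f rangeI)
  then have "0 \<le> inv std_normal_cdf (1 - r_star b)"
    using std_normal_cdf_nonpos_le_half[of "inv std_normal_cdf (1 - r_star b)"] r by linarith
  then show ?thesis
    using assms by (simp add: K2_ER_def)
qed

section \<open>Properties (A) and (B) for the laws of the chain\<close>

text \<open>For the dynamics started in \<open>y\<close> and considered at day 0 the conditioning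
  event is the whole space, so (A) becomes a statement on \<open>step_law\<close>; the recursion of
  \<open>dynamics_law\<close> carries it to later days.\<close>

lemma stepwise_amplification_step_law:
  assumes "stepwise_amplification b K c1 C2 c"
  shows "\<forall>\<^sub>F N in sequentially. \<forall>y \<in> configs N.
    sqrt (real N / ln (real N)) \<le> advantage N y \<longrightarrow>
    advantage N y \<le> K * real N / sqrt (ln (real N)) \<longrightarrow>
    measure_pmf.prob (step_law N (b * ln (real N) / real N) y)
      {z. \<not> step_ok N (c1 * sqrt (ln (real N))) (C2 * sqrt (ln (real N))) y z}
    \<le> 2 * exp (- (c * ln (real N) / real N) * (advantage N y)\<^sup>2)"
  using assms unfolding stepwise_amplification_def Let_def
proof eventually_elim
  case (elim N)
  let ?p = "b * ln (real N) / real N"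
  let ?g = "c1 * sqrt (ln (real N))" and ?D = "C2 * sqrt (ln (real N))"
  show ?case
  proof (intro ballI impI)
    fix y assume y: "y \<in> configs N" and lo: "sqrt (real N / ln (real N)) \<le> advantage N y"
      and hi: "advantage N y \<le> K * real N / sqrt (ln (real N))"
    have [simp]: "measure (graph_space N ?p) UNIV = 1"
      using graph_space.prob_space[of N ?p] by simp
    have "1 - 2 * exp (- (c * (advantage N y)\<^sup>2 * ln (real N) / real N))
        \<le> \<P>(G in graph_space N ?p. step_ok N ?g ?D y (majority_dynamics N y G (Suc 0)))"
      using elim[THEN bspec[OF _ y], THEN spec[of _ 0], THEN bspec[OF _ y]] lo hi
      by (simp add: cond_prob_def step_ok_def)
    also have "\<dots> = measure_pmf.prob (step_law N ?p y) {z. step_ok N ?g ?D y z}"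
      using prob_majority_dynamics[OF y, of ?p "Suc 0" "{z. step_ok N ?g ?D y z}"]
      by (simp only: mem_Collect_eq dynamics_law_1)
    also have "\<dots> = 1 - measure_pmf.prob (step_law N ?p y) {z. \<not> step_ok N ?g ?D y z}"
      using measure_pmf.prob_compl[of "{z. \<not> step_ok N ?g ?D y z}" "step_law N ?p y"]
      by (simp add: Compl_eq_Diff_UNIV[symmetric] Collect_neg_eq[symmetric])
    finally show "measure_pmf.prob (step_law N ?p y) {z. \<not> step_ok N ?g ?D y z}
        \<le> 2 * exp (- (c * ln (real N) / real N) * (advantage N y)\<^sup>2)"
      by (simp add: mult_ac)
  qed
qed

lemma two_day_unanimity_dynamics_law:
  assumes "two_day_unanimity b K \<xi>"
  shows "\<forall>\<^sub>F N in sequentially. \<forall>y \<in> configs N.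
    K * real N / sqrt (ln (real N)) \<le> advantage N y \<longrightarrow>
    measure_pmf.prob (dynamics_law N (b * ln (real N) / real N) 2 y) {z. red N z \<noteq> {}}
    \<le> 2 * exp (- (ln (real N))\<^sup>2) + 2 * real N powr (- \<xi>)"
  using assms unfolding two_day_unanimity_def
proof eventually_elim
  case (elim N)
  let ?p = "b * ln (real N) / real N"
  show ?case
  proof (intro ballI impI)
    fix y assume y: "y \<in> configs N" and hi: "K * real N / sqrt (ln (real N)) \<le> advantage N y"
    have "1 - 2 * exp (- (ln (real N))\<^sup>2) - 2 * real N powr (- \<xi>)
        \<le> \<P>(G in graph_space N ?p. majority_dynamics N y G 2 \<in> {z. red N z = {}})"
      using elim y hi by simp
    also have "\<dots> = measure_pmf.prob (dynamics_law N ?p 2 y) {z. red N z = {}}"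
      by (rule prob_majority_dynamics[OF y])
    also have "\<dots> = 1 - measure_pmf.prob (dynamics_law N ?p 2 y) {z. red N z \<noteq> {}}"
      using measure_pmf.prob_compl[of "{z. red N z \<noteq> {}}" "dynamics_law N ?p 2 y"]
      by (simp add: Compl_eq_Diff_UNIV[symmetric] Collect_neg_eq[symmetric])
    finally show "measure_pmf.prob (dynamics_law N ?p 2 y) {z. red N z \<noteq> {}}
        \<le> 2 * exp (- (ln (real N))\<^sup>2) + 2 * real N powr (- \<xi>)"
      by simp
  qed
qed

section \<open>Asymptotics of the two times\<close>

lemma filterlim_ln_real: "filterlim (\<lambda>N. ln (real N)) at_top sequentially"
  by real_asymp

lemma sqrt_exp: "sqrt (exp x) = exp (x / 2)"
  by (rule real_sqrt_unique) (simp_all add: exp_double[symmetric])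

text \<open>From the lower end of the window to the threshold a factor \<open>K * sqrt N\<close> is
  missing, that is \<open>ln K + L / 2\<close> in logarithms with \<open>L = ln N\<close>. A day
  gains \<open>ln (c1 * sqrt L)\<close>, asymptotically \<open>ln L / 2\<close>; the surplus from
  \<open>\<delta>\<close> absorbs the constants and the two days reserved for (B).\<close>

lemma eventually_upper_time:
  fixes c1 K \<delta> :: real
  assumes "c1 > 0" "K > 0" "\<delta> > 0"
  shows "\<forall>\<^sub>F N in sequentially. \<exists>n.
    nat \<lceil>(1 + \<delta>) * (ln (real N) / ln (ln (real N)))\<rceil> = n + 2 \<and>
    K * real N / sqrt (ln (real N)) \<le> (c1 * sqrt (ln (real N))) ^ n * sqrt (real N / ln (real N))"
proof -
  have "\<forall>\<^sub>F L in at_top. ((1 + \<delta>) * (L / ln L) - 2) * ln (c1 * sqrt L) > ln K + L / 2"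
    "\<forall>\<^sub>F L in at_top. c1 * sqrt L \<ge> 2" "\<forall>\<^sub>F L in at_top. (1 + \<delta>) * (L / ln L) \<ge> 2"
    using assms by real_asymp+
  note this[THEN eventually_compose_filterlim[OF _ filterlim_ln_real]]
  then show ?thesis
    using eventually_gt_at_top[of 1]
  proof eventually_elim
    case (elim N)
    define L where "L = ln (real N)"
    define q where "q = (1 + \<delta>) * (L / ln L)"
    define n where "n = nat \<lceil>q\<rceil> - 2"
    note elim = elim(1-3)[folded L_def, folded q_def] elim(4)
    have "0 < L"
      using elim by (simp add: L_def)
    have "real N = exp L"
      using elim by (simp add: L_def)
    \<comment> \<open>This makes the truncated subtraction in \<open>n\<close> exact.\<close>
    have "2 \<le> nat \<lceil>q\<rceil>"
      using elim(3) by linarith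
    then have n: "nat \<lceil>q\<rceil> = n + 2"
      by (simp add: n_def)
    then have "q - 2 \<le> real n"
      by linarith
    then have "ln K + L / 2 \<le> real n * ln (c1 * sqrt L)"
      using elim(1,2) mult_right_mono[of "q - 2" "real n" "ln (c1 * sqrt L)"] ln_ge_zero[of "c1 * sqrt L"]
      by linarith
    then have "exp (ln K + L / 2) \<le> exp (real n * ln (c1 * sqrt L))"
      by simp
    then have "K * exp (L / 2) \<le> (c1 * sqrt L) ^ n"
      using elim(2) assms(2) by (simp add: exp_add exp_of_nat_mult)
    then have "K * sqrt (real N) \<le> (c1 * sqrt L) ^ n"
      by (simp add: \<open>real N = exp L\<close> sqrt_exp)
    then have "K * sqrt (real N) * sqrt (real N / L) \<le> (c1 * sqrt L) ^ n * sqrt (real N / L)"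
      using \<open>0 < L\<close> by (intro mult_right_mono) auto
    then have "K * real N / sqrt L \<le> (c1 * sqrt L) ^ n * sqrt (real N / L)"
      by (simp add: real_sqrt_divide mult.assoc)
    then show ?case
      using n by (auto simp: L_def q_def)
  qed
qed

text \<open>In logarithms \<open>x\<close> is \<open>(1 - \<delta>) * L / 2 + L / 2\<close> up to
  \<open>o(L)\<close>, whereas both bounds are \<open>L\<close> up to \<open>o(L)\<close>.\<close>

lemma eventually_lower_time:
  fixes C C2 K \<delta> :: real
  assumes "C > 0" "C2 > 0" "K > 0" "0 < \<delta>" "\<delta> < 1"
  shows "\<forall>\<^sub>F N in sequentially.
    let m = nat \<lfloor>(1 - \<delta>) * (ln (real N) / ln (ln (real N)))\<rfloor>;
        x = (C2 * sqrt (ln (real N))) ^ m * (C * sqrt (real N))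
    in x \<le> K * real N / sqrt (ln (real N)) \<and> x < real N"
proof -
  have "\<forall>\<^sub>F L in at_top.
      (1 - \<delta>) * (L / ln L) * ln (C2 * sqrt L) + ln C + L / 2 < ln K + L - ln (sqrt L)"
    "\<forall>\<^sub>F L in at_top. (1 - \<delta>) * (L / ln L) * ln (C2 * sqrt L) + ln C + L / 2 < L"
    "\<forall>\<^sub>F L in at_top. C2 * sqrt L \<ge> 1" "\<forall>\<^sub>F L in at_top. (1 - \<delta>) * (L / ln L) \<ge> 0"
    using assms by real_asymp+
  note this[THEN eventually_compose_filterlim[OF _ filterlim_ln_real]]
  then show ?thesis
    using eventually_gt_at_top[of 1]
  proof eventually_elim
    case (elim N)
    define L where "L = ln (real N)"
    define q where "q = (1 - \<delta>) * (L / ln L)"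
    define m where "m = nat \<lfloor>q\<rfloor>"
    define x where "x = (C2 * sqrt L) ^ m * (C * sqrt (real N))"
    note elim = elim(1-4)[folded L_def, folded q_def] elim(5)
    have "0 < L" and N: "real N = exp L"
      using elim by (simp_all add: L_def)
    \<comment> \<open>This relies on \<open>q \<ge> 0\<close>, since \<open>nat\<close> sends a
      negative floor to 0.\<close>
    have "real m \<le> q"
      using elim(4) by (simp add: m_def)
    then have *: "real m * ln (C2 * sqrt L) \<le> q * ln (C2 * sqrt L)"
      using elim(3) by (intro mult_right_mono ln_ge_zero)
    have x: "x = exp (real m * ln (C2 * sqrt L) + ln C + L / 2)"
      using elim(3) assms(1) by (simp add: x_def N sqrt_exp exp_add exp_of_nat_mult)
    have "x \<le> exp (ln K + L - ln (sqrt L))"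
      unfolding x using * elim(1) by simp
    also have "\<dots> = K * real N / sqrt L"
      using \<open>0 < L\<close> assms(3) by (simp add: exp_add exp_diff N)
    finally have "x \<le> K * real N / sqrt L" .
    moreover have "x < real N"
      unfolding x N using * elim(2) by simp
    ultimately show ?case
      by (simp add: x_def m_def q_def L_def Let_def)
  qed
qed

section \<open>Combination of the early and the late bound\<close>

theorem corollary1p6:
  fixes b K c1 C2 c \<xi> \<delta> :: real
    and h :: "nat \<Rightarrow> real"
    and y0 :: "nat \<Rightarrow> nat \<Rightarrow> int"
  assumes "b > 1"
    and "K > K2_ER b"
    and "c1 > 0" "C2 > 0" "c > 0" "\<xi> > 0"
    and "stepwise_amplification b K c1 C2 c"
    and "two_day_unanimity b K \<xi>"
    and "\<And>N. h N \<ge> 1"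
    and "h \<in> o(\<lambda>N. sqrt (ln (real N)))"
    and "\<And>N. y0 N \<in> configs N"
    and "\<forall>\<^sub>F N in sequentially. red N (y0 N) \<noteq> {}"
    and "\<forall>\<^sub>F N in sequentially. advantage N (y0 N) \<ge> sqrt (real N) / h N"
    and "(\<lambda>N. advantage N (y0 N)) \<in> \<Theta>(\<lambda>N. sqrt (real N) / h N)"
    and "0 < \<delta>" "\<delta> < 1"
  shows "\<forall>\<^sub>F N in sequentially.
    \<P>(G in graph_space N (b * ln (real N) / real N).
        red N (majority_dynamics N (y0 N) G
                 (nat \<lfloor>(1 - \<delta>) * (ln (real N) / ln (ln (real N)))\<rfloor>)) \<noteq> {} \<and>
        red N (majority_dynamics N (y0 N) G
                 (nat \<lceil>(1 + \<delta>) * (ln (real N) / ln (ln (real N)))\<rceil>)) = {})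
    \<ge> 1 - eta c \<xi> N (advantage N (y0 N))"
proof -
  \<comment> \<open>The time estimates use \<open>exp (ln K) = K\<close>.\<close>
  have "K > 0"
    using K2_ER_nonneg[OF \<open>b > 1\<close>] \<open>K > K2_ER b\<close> by linarith
  obtain C where "C > 0" and
    C: "\<forall>\<^sub>F N in sequentially. norm (advantage N (y0 N)) \<le> C * norm (sqrt (real N) / h N)"
    using bigthetaD1[OF assms(14)] by (elim landau_o.bigE)
  \<comment> \<open>The smallness of \<open>h\<close> enters with two constants: 1 puts the initial
    advantage above the lower end of the window, and \<open>sqrt c\<close> gives
    \<open>\<kappa> * x\<^sup>2 \<ge> 1\<close>, as \<open>err_le\<close> requires.\<close>
  have "\<forall>\<^sub>F N in sequentially. norm (h N) \<le> 1 * norm (sqrt (ln (real N)))"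
    using assms(10) by (rule landau_o.smallD) simp
  moreover have "\<forall>\<^sub>F N in sequentially. norm (h N) \<le> sqrt c * norm (sqrt (ln (real N)))"
    using assms(10) by (rule landau_o.smallD) (use \<open>c > 0\<close> in simp)
  moreover have "\<forall>\<^sub>F N in sequentially. 2 \<le> c1 * sqrt (ln (real N)) \<and> 1 \<le> C2 * sqrt (ln (real N))"
    using \<open>c1 > 0\<close> \<open>C2 > 0\<close> by (intro eventually_conj; real_asymp)
  ultimately show ?thesis
    using stepwise_amplification_step_law[OF assms(7)] two_day_unanimity_dynamics_law[OF assms(8)]
      eventually_upper_time[OF \<open>c1 > 0\<close> \<open>K > 0\<close> \<open>0 < \<delta>\<close>]
      eventually_lower_time[OF \<open>C > 0\<close> \<open>C2 > 0\<close> \<open>K > 0\<close> \<open>0 < \<delta>\<close> \<open>\<delta> < 1\<close>]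
      C assms(13) eventually_gt_at_top[of 1]
  proof eventually_elim
    case (elim N)
    define L where "L = ln (real N)"
    define p where "p = b * L / real N"
    define y where "y = y0 N"
    define x where "x = advantage N y"
    define m where "m = nat \<lfloor>(1 - \<delta>) * (L / ln L)\<rfloor>"
    define m' where "m' = nat \<lceil>(1 + \<delta>) * (L / ln L)\<rceil>"
    define H where "H = K * real N / sqrt L"
    define \<epsilon> where "\<epsilon> = 2 * exp (- L\<^sup>2) + 2 * real N powr (- \<xi>)"
    define \<kappa> where "\<kappa> = c * L / real N"
    note defs = L_def p_def y_def x_def m_def m'_def H_def \<epsilon>_def \<kappa>_def
    have "N > 1" "0 < L" and y: "y \<in> configs N"
      using elim(10) assms(11) by (simp_all add: L_def y_def)
    have h: "1 \<le> h N" "h N \<le> sqrt L" "h N \<le> sqrt c * sqrt L"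
      using elim(1,2) assms(9)[of N] \<open>0 < L\<close> by (simp_all add: L_def)
    have x: "sqrt (real N) / h N \<le> x"
      using elim(9) by (simp add: x_def y_def)
    interpret amplification N p "c1 * sqrt L" "C2 * sqrt L" "sqrt (real N / L)" H \<kappa>
      using elim(3,4) \<open>c > 0\<close> \<open>0 < L\<close> \<open>N > 1\<close> by unfold_locales (auto simp: defs)
    have "sqrt (real N / L) \<le> sqrt (real N) / h N"
      using h \<open>0 < L\<close> by (simp add: real_sqrt_divide frac_le)
    with x have low: "sqrt (real N / L) \<le> x"
      by linarith
    then have "0 < x"
      using s by linarith
    have "x \<le> C * (sqrt (real N) / h N)"
      using elim(8) h \<open>0 < x\<close> by (simp add: x_def y_def)
    also have "\<dots> \<le> C * sqrt (real N)"
      using h \<open>C > 0\<close> by (intro mult_left_mono) (auto simp: divide_le_eq mult_le_cancel_left1)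
    finally have "x \<le> C * sqrt (real N)" .
    then have "(C2 * sqrt L) ^ m * x \<le> (C2 * sqrt L) ^ m * (C * sqrt (real N))"
      using D by (intro mult_left_mono) auto
    then have "(C2 * sqrt L) ^ m * x \<le> H" "(C2 * sqrt L) ^ m * x < real N"
      using elim(7) by (simp_all add: Let_def defs)
    then have early: "measure_pmf.prob (dynamics_law N p m y) {z. red N z = {}} \<le> err m x"
      using prob_red_empty_le[OF y] low by (simp add: x_def)
    obtain n where n: "m' = n + 2" "H \<le> (c1 * sqrt L) ^ n * sqrt (real N / L)"
      using elim(6) by (auto simp: defs)
    have "(c1 * sqrt L) ^ n * sqrt (real N / L) \<le> (c1 * sqrt L) ^ n * x"
      using g low by (intro mult_left_mono) auto
    with n have "H \<le> (c1 * sqrt L) ^ n * x"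
      by linarith
    then have late: "measure_pmf.prob (dynamics_law N p m' y) {z. red N z \<noteq> {}} \<le> err n x + \<epsilon>"
      unfolding n(1) x_def using elim(5) y low
      by (intro prob_red_nonempty_le) (auto simp: defs)
    have "sqrt (real N) \<le> x * h N"
      using x h by (simp add: divide_le_eq)
    also have "\<dots> \<le> x * (sqrt c * sqrt L)"
      using h \<open>0 < x\<close> by (intro mult_left_mono) auto
    finally have "(sqrt (real N))\<^sup>2 \<le> (x * (sqrt c * sqrt L))\<^sup>2"
      by (intro power_mono) auto
    then have "1 \<le> \<kappa> * x\<^sup>2"
      using \<open>N > 1\<close> \<open>0 < L\<close> \<open>c > 0\<close> by (simp add: power_mult_distrib \<kappa>_def field_simps)
    then have err: "err k x \<le> 4 * exp (- \<kappa> * x\<^sup>2)" for k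
      using err_le elim(3) by (simp add: L_def)
    \<comment> \<open>\<open>A\<close> is unanimity too early, \<open>B\<close> is red surviving too
      long. The laws of the chain bound them one day at a time; the union bound joins them on the
      space of graph sequences.\<close>
    define A where "A = {G. majority_dynamics N y G m \<in> {z. red N z = {}}}"
    define B where "B = {G. majority_dynamics N y G m' \<in> {z. red N z \<noteq> {}}}"
    have sets: "A \<in> sets (graph_space N p)" "B \<in> sets (graph_space N p)"
      unfolding A_def B_def by (rule sets_majority_dynamics[OF y])+
    have "graph_space.prob N p A \<le> err m x" "graph_space.prob N p B \<le> err n x + \<epsilon>"
      using early late prob_majority_dynamics[OF y, of p m "{z. red N z = {}}"]
        prob_majority_dynamics[OF y, of p m' "{z. red N z \<noteq> {}}"]
      by (simp_all add: A_def B_def)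
    moreover have "graph_space.prob N p (A \<union> B) \<le> graph_space.prob N p A + graph_space.prob N p B"
      by (rule measure_Un_le[OF sets])
    moreover have "graph_space.prob N p (space (graph_space N p) - (A \<union> B)) =
        1 - graph_space.prob N p (A \<union> B)"
      using sets by (intro graph_space.prob_compl) auto
    ultimately have "1 - (8 * exp (- \<kappa> * x\<^sup>2) + \<epsilon>)
        \<le> graph_space.prob N p (space (graph_space N p) - (A \<union> B))"
      using err[of m] err[of n] by linarith
    also have "8 * exp (- \<kappa> * x\<^sup>2) + \<epsilon> = eta c \<xi> N x"
      by (simp add: eta_def \<epsilon>_def \<kappa>_def L_def mult_ac)
    also have "space (graph_space N p) - (A \<union> B) = {G \<in> space (graph_space N p).
        red N (majority_dynamics N y G m) \<noteq> {} \<and> red N (majority_dynamics N y G m') = {}}"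
      by (auto simp: A_def B_def)
    finally show ?case
      by (simp only: defs)
  qed
qed

end
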